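(* Let $(A,\lambda,v)\in\mathcal{W}$. Then $$ \mu(A,\lambda,v)\leq \max\left\{1,\ \frac{1}{\left(1+\frac{|\lambda|^2}{\|A\|_F^2}\right)^{1/2}}\cdot\frac{1}{\sin\left(d_{\mathbb{P}^2}\big((A,\lambda,v),\Sigma'\cap\mathcal{V}_v\big)\right)}\right\}. $$
   Context: $\mathbb{K}$ denotes $\mathbb{R}$ or $\mathbb{C}$ and $n\ge 2$. $\mathbb{P}(\mathbb{E})$ is the projective space of a vector space $\mathbb{E}$ over $\mathbb{K}$; points of projective spaces are denoted by nonzero representatives. $\mathbb{K}^n$ has its canonical Hermitian product, $\mathbb{K}^{n\times n}$ the Frobenius product $\langle A,B\rangle_F=\mathrm{trace}(B^*A)$ with norm $\|\cdot\|_F$, $\mathbb{K}^{n\times n}\times\mathbb{K}$ the product Hermitian structure, and $\|\cdot\|$ is the operator norm on linear maps. The solution variety is $\mathcal{V}=\{(A,\lambda,v)\in\mathbb{P}(\mathbb{K}^{n\times n}\times\mathbb{K})\times\mathbb{P}(\mathbb{K}^n):(\lambda I_n-A)v=0\}$ (note that $A\neq 0$ for such triples). $\mathcal{W}\subset\mathcal{V}$ is the set of well-posed triples, i.e. those for which $\lambda$ is a simple eigenvalue of $A$ (algebraic multiplicity one), and $\Sigma'=\mathcal{V}\setminus\mathcal{W}$ is the ill-posed variety. For $v\in\mathbb{P}(\mathbb{K}^n)$, $\mathcal{V}_v$ is the set of triples of $\mathcal{V}$ whose last component is $v$. $\Pi_{v^\perp}$ is the orthogonal projection of $\mathbb{K}^n$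 onto the Hermitian complement $v^\perp$ of $v$; for $(A,\lambda,v)\in\mathcal{W}$ the operator $\Pi_{v^\perp}(\lambda I_n-A)|_{v^\perp}$ from $v^\perp$ to itself is invertible. The condition number is $\mu(A,\lambda,v)=\max\{1,\ \|A\|_F\,\|(\Pi_{v^\perp}(\lambda I_n-A)|_{v^\perp})^{-1}\|\}$ (independent of representatives). For a Hermitian space $\mathbb{E}$, $\mathbb{P}(\mathbb{E})$ carries the metric $\langle w,w'\rangle_x=\langle w,w'\rangle/\|x\|^2$ for $w,w'\in x^\perp\cong T_x\mathbb{P}(\mathbb{E})$, whose distance is the angle $d_{\mathbb{P}}(x,y)=\arccos\frac{|\langle x,y\rangle|}{\|x\|\|y\|}$. $d_{\mathbb{P}^2}$ is the Riemannian distance of the product metric on $\mathbb{P}(\mathbb{K}^{n\times n}\times\mathbb{K})\times\mathbb{P}(\mathbb{K}^n)$: $d_{\mathbb{P}^2}((A,\lambda,v),(A',\lambda',v'))=\big(d_{\mathbb{P}}((A,\lambda),(A',\lambda'))^2+d_{\mathbb{P}}(v,v')^2\big)^{1/2}$. The distance from a point to a set is the infimum of the distances to its points. *)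

theory Defs
  imports "HOL-Analysis.Analysis" "HOL-Computational_Algebra.Polynomial"
begin

text \<open>
  A common interface to the two ground fields, so that the notions below are defined once for
  \<^typ>\<open>real\<close> and \<^typ>\<open>complex\<close>.
\<close>

class conj_normed_field = real_normed_field + euclidean_space +
  fixes conjug :: "'a \<Rightarrow> 'a"
  assumes conjug_add: "conjug (x + y) = conjug x + conjug y"
    and mult_conjug: "x * conjug x = (norm x)\<^sup>2 *\<^sub>R 1"

instantiation real :: conj_normed_field
begin
definition conjug_real :: "real \<Rightarrow> real" where "conjug_real x = x"
instance by standard (simp_all add: conjug_real_def power2_eq_square)
end

instantiation complex :: conj_normed_field
begin
definition conjug_complex :: "complex \<Rightarrow> complex" where "conjug_complex z = cnj z"
instance by standard (simp_all add: conjug_complex_def complex_norm_square[symmetric] scaleR_conv_of_real)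
end

definition herm_prod :: "'k::conj_normed_field ^ 'n \<Rightarrow> 'k ^ 'n \<Rightarrow> 'k" where
  "herm_prod x y = (\<Sum>i\<in>UNIV. x $ i * conjug (y $ i))"

definition conj_transpose :: "'k::conj_normed_field ^ 'n ^ 'm \<Rightarrow> 'k ^ 'm ^ 'n" where
  "conj_transpose A = (\<chi> i j. conjug (A $ j $ i))"

definition frob_prod :: "'k::conj_normed_field ^ 'n ^ 'n \<Rightarrow> 'k ^ 'n ^ 'n \<Rightarrow> 'k" where
  "frob_prod A B = trace (conj_transpose B ** A)"

definition pair_prod ::
  "('k::conj_normed_field ^ 'n ^ 'n) \<times> 'k \<Rightarrow> ('k ^ 'n ^ 'n) \<times> 'k \<Rightarrow> 'k" where
  "pair_prod = (\<lambda>(A, l) (B, m). frob_prod A B + l * conjug m)"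

text \<open>
  The norms induced by these Hermitian products are the norms of the library types; in
  particular \<^term>\<open>norm A\<close> for a matrix \<^term>\<open>A\<close> is the Frobenius norm, not the operator norm.
\<close>

lemma mult_conjug_of_real: "x * conjug x = of_real ((norm x)\<^sup>2)"
  by (simp add: mult_conjug of_real_def)

lemma herm_prod_self: "herm_prod x x = of_real ((norm x)\<^sup>2)"
  by (simp add: herm_prod_def norm_vec_def L2_set_def mult_conjug_of_real sum_nonneg)

lemma frob_prod_self: "frob_prod A A = of_real ((norm A)\<^sup>2)"
proof -
  have "frob_prod A A = (\<Sum>i\<in>UNIV. \<Sum>k\<in>UNIV. A $ k $ i * conjug (A $ k $ i))"
    by (simp add: frob_prod_def trace_def conj_transpose_def matrix_matrix_mult_def mult.commute)
  also have "\<dots> = (\<Sum>k\<in>UNIV. \<Sum>i\<in>UNIV. A $ k $ i * conjug (A $ k $ i))"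
    by (rule sum.swap)
  also have "\<dots> = of_real ((norm A)\<^sup>2)"
    by (simp add: norm_vec_def L2_set_def mult_conjug_of_real sum_nonneg)
  finally show ?thesis .
qed

lemma pair_prod_self: "pair_prod x x = of_real ((norm x)\<^sup>2)"
  by (cases x) (simp add: pair_prod_def frob_prod_self mult_conjug_of_real norm_Pair)

text \<open>
  Points of projective spaces are given by nonzero representatives. The distance takes the
  Hermitian product as a parameter.
\<close>

definition proj_eq :: "'k::field ^ 'n \<Rightarrow> 'k ^ 'n \<Rightarrow> bool" where
  "proj_eq v w \<longleftrightarrow> (\<exists>c. c \<noteq> 0 \<and> w = c *s v)"

definition proj_dist ::
  "('e::real_normed_vector \<Rightarrow> 'e \<Rightarrow> 'k::conj_normed_field) \<Rightarrow> 'e \<Rightarrow> 'e \<Rightarrow> real" where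
  "proj_dist h x y = arccos (norm (h x y) / (norm x * norm y))"

type_synonym ('k, 'n) triple = "('k ^ 'n ^ 'n) \<times> 'k \<times> ('k ^ 'n)"

definition proj2_dist ::
  "('k::conj_normed_field, 'n::finite) triple \<Rightarrow> ('k, 'n) triple \<Rightarrow> real" where
  "proj2_dist = (\<lambda>(A, l, v) (A', l', v').
     sqrt ((proj_dist pair_prod (A, l) (A', l'))\<^sup>2 + (proj_dist herm_prod v v')\<^sup>2))"

definition proj2_setdist ::
  "('k::conj_normed_field, 'n::finite) triple \<Rightarrow> ('k, 'n) triple set \<Rightarrow> real" where
  "proj2_setdist x S = (INF y\<in>S. proj2_dist x y)"

definition charpoly :: "'k::field ^ 'n ^ 'n \<Rightarrow> 'k poly" where
  "charpoly A = det (mat [:0, 1:] - (\<chi> i j. [:A $ i $ j:]))"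

text \<open>\<^term>\<open>mat l\<close> is \<^term>\<open>l\<close> times the identity matrix.\<close>

definition solution_variety :: "('k::conj_normed_field, 'n::finite) triple set" where
  "solution_variety = {(A, l, v). (A, l) \<noteq> 0 \<and> v \<noteq> 0 \<and> (mat l - A) *v v = 0}"

definition well_posed :: "('k::conj_normed_field, 'n::finite) triple set" where
  "well_posed = {(A, l, v) \<in> solution_variety. order l (charpoly A) = 1}"

definition ill_posed :: "('k::conj_normed_field, 'n::finite) triple set" where
  "ill_posed = solution_variety - well_posed"

definition fibre :: "'k::conj_normed_field ^ 'n \<Rightarrow> ('k, 'n) triple set" where
  "fibre v = {(A, l, w) \<in> solution_variety. proj_eq v w}"

definition perp :: "'k::conj_normed_field ^ 'n \<Rightarrow> ('k ^ 'n) set" where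
  "perp v = {w. herm_prod w v = 0}"

definition proj_perp :: "'k::conj_normed_field ^ 'n \<Rightarrow> 'k ^ 'n \<Rightarrow> 'k ^ 'n" where
  "proj_perp v x = x - (herm_prod x v / herm_prod v v) *s v"

text \<open>The operator norm of a map on a subspace, as in \<^const>\<open>onorm\<close>.\<close>

definition onorm_on :: "'a::real_normed_vector set \<Rightarrow> ('a \<Rightarrow> 'b::real_normed_vector) \<Rightarrow> real" where
  "onorm_on S f = (SUP x\<in>S. norm (f x) / norm x)"

definition perp_op ::
  "'k::conj_normed_field ^ 'n ^ 'n \<Rightarrow> 'k \<Rightarrow> 'k ^ 'n \<Rightarrow> 'k ^ 'n \<Rightarrow> 'k ^ 'n" where
  "perp_op A l v w = proj_perp v ((mat l - A) *v w)"

text \<open>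
  Only the restriction of \<^term>\<open>perp_op A l v\<close> to \<^term>\<open>perp v\<close> is inverted, hence
  \<^const>\<open>inv_into\<close>. It is a bijection of \<^term>\<open>perp v\<close> when the triple is well-posed.
\<close>

definition cond_number :: "('k::conj_normed_field, 'n::finite) triple \<Rightarrow> real" where
  "cond_number = (\<lambda>(A, l, v).
     max 1 (norm A * onorm_on (perp v) (inv_into (perp v) (perp_op A l v))))"

end

theory Submission
  imports Defs
begin

text \<open>
  Write \<open>T\<close> for the compression \<^term>\<open>perp_op A l v\<close> of \<^term>\<open>mat l - A\<close> to the orthogonal
  complement of the eigenvector \<^term>\<open>v\<close>. The theorem is the easy half of an Eckart--Young
  argument: a linear map that shrinks some vector \<^term>\<open>x\<close> to \<^term>\<open>w\<close> is made singular by a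
  perturbation of size \<^term>\<open>norm w / norm x\<close>. If \<open>T\<close> maps \<^term>\<open>x\<close> to \<^term>\<open>w\<close>, adding to
  \<^term>\<open>A\<close> the rank-one matrix that sends \<^term>\<open>x\<close> to \<^term>\<open>w\<close> and vanishes on
  the complement of \<^term>\<open>x\<close> gives a matrix \<^term>\<open>A'\<close> with the same eigenpair and a
  singular compression, that is, an ill-posed triple with the same \<^term>\<open>l\<close> and
  \<^term>\<open>v\<close>. The sine of an angle between two lines is the distance from a unit vector of one to the
  other (\<open>sin_proj_dist_le\<close>), so the sine of the distance \<open>d\<close> to the ill-posed triples over
  \<^term>\<open>v\<close> is at most \<^term>\<open>norm w / (norm x * norm (A, l))\<close> (\<open>sin_setdist_le\<close>). The
  supremum over \<^term>\<open>w\<close> bounds the norm of the inverse of \<open>T\<close> by the reciprocal of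
  \<open>norm (A, l) * sin d\<close>, and multiplying by \<^term>\<open>norm A\<close> gives the bound (\<open>cond_number_le\<close>).

  Three points need care.

  \<^item> Well-posedness is a condition on the characteristic polynomial. That it amounts to the
    injectivity of \<open>T\<close> is shown in \<open>simple_eigenvalue_iff\<close>, by an argument with Cramer's rule.

  \<^item> The bound divides by \<open>sin d\<close>, so \<open>d\<close> must be positive. This is quantitative: \<open>T\<close> is bounded from
    below, ill-posed triples have a singular compression, and the compression depends
    continuously on the triple (\<open>ill_posed_fibre_bounded_away\<close>).

  \<^item> If \<^term>\<open>l = 0\<close>, the matrix \<^term>\<open>A'\<close> can vanish and is then not a point of the projective
    space. In that case \<^term>\<open>norm A * norm x = norm w\<close>, and the maximum with 1 takes
    care of it.

  The argument treats both ground fields at once, over the class that they share.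
\<close>

section \<open>Conjugation in the common field interface\<close>

lemma conjug_zero [simp]: "conjug (0::'k::conj_normed_field) = 0"
  using conjug_add[of "0::'k" 0] by simp

text \<open>
  Since \<^term>\<open>x * conjug x\<close> is real and the norm is multiplicative, the two axioms of the class
  already determine the conjugation by this formula; it makes \<^const>\<open>conjug\<close> a multiplicative
  involution that fixes the reals.
\<close>

lemma conjug_eq: "x \<noteq> 0 \<Longrightarrow> conjug x = of_real ((norm x)\<^sup>2) / (x::'k::conj_normed_field)"
  using mult_conjug_of_real[of x] by (simp add: field_simps)

lemma conjug_mult: "conjug (x * y) = conjug x * conjug (y::'k::conj_normed_field)"
  by (cases "x = 0"; cases "y = 0") (simp_all add: conjug_eq norm_mult power_mult_distrib)

lemma norm_conjug [simp]: "norm (conjug (x::'k::conj_normed_field)) = norm x"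
  by (cases "x = 0") (simp_all add: conjug_eq norm_divide norm_mult power2_eq_square)

lemma conjug_conjug [simp]: "conjug (conjug (x::'k::conj_normed_field)) = x"
proof (cases "x = 0")
  case False
  then have "conjug x \<noteq> 0" using norm_conjug[of x] by fastforce
  then have "conjug (conjug x) = of_real ((norm x)\<^sup>2) / conjug x" by (simp add: conjug_eq)
  also have "\<dots> = x" using False by (simp add: conjug_eq)
  finally show ?thesis .
qed simp

lemma conjug_of_real [simp]: "conjug (of_real r :: 'k::conj_normed_field) = of_real r"
  by (cases "r = 0") (simp_all add: conjug_eq power2_eq_square)

lemma conjug_minus: "conjug (- x) = - conjug (x::'k::conj_normed_field)"
  using conjug_add[of x "- x"] by (simp add: eq_neg_iff_add_eq_0 add.commute)

lemma conjug_diff: "conjug (x - y) = conjug x - conjug (y::'k::conj_normed_field)"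
  using conjug_add[of x "- y"] by (simp add: conjug_minus)

lemma conjug_sum: "conjug (sum f S) = (\<Sum>i\<in>S. conjug (f i :: 'k::conj_normed_field))"
  by (induction S rule: infinite_finite_induct) (simp_all add: conjug_add)

section \<open>Hermitian forms and the sine of the projective distance\<close>

text \<open>
  The projective distance occurs both for vectors and for pairs of a matrix and a scalar. The
  parameter \<^term>\<open>sc\<close> is the multiplication by scalars of the ground field, which differs
  between the two.
\<close>

locale hermitian_form =
  fixes h :: "'e::real_normed_vector \<Rightarrow> 'e \<Rightarrow> 'k::conj_normed_field"
    and sc :: "'k \<Rightarrow> 'e \<Rightarrow> 'e"
  assumes add_left: "h (x + y) z = h x z + h y z"
    and scale_left: "h (sc c x) y = c * h x y"
    and conj_sym: "conjug (h x y) = h y x"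
    and self: "h x x = of_real ((norm x)\<^sup>2)"
begin

lemma add_right: "h z (x + y) = h z x + h z y"
  using add_left conj_sym conjug_add by metis

lemma minus_left: "h (- x) y = - h x y"
proof -
  have "h 0 y = 0" using add_left[of 0 0 y] by simp
  then show ?thesis using add_left[of x "- x" y] by (simp add: eq_neg_iff_add_eq_0 add.commute)
qed

lemma diff_left: "h (x - z) y = h x y - h z y"
  using add_left[of x "- z" y] by (simp add: minus_left)

lemma diff_right: "h y (x - z) = h y x - h y z"
  using diff_left conj_sym conjug_diff by metis

lemma scale_right: "h x (sc c y) = conjug c * h x y"
  using scale_left conj_sym conjug_mult by metis

text \<open>
  Split \<^term>\<open>x - sc c y\<close> into its parts orthogonal and parallel to \<^term>\<open>y\<close>. Multiplying by
  \<^term>\<open>(norm y)\<^sup>2\<close> removes the quotients. The minimum over \<^term>\<open>c\<close>, the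
  Cauchy--Schwarz inequality and the formula for the sine of the angle are all read off from
  this identity.
\<close>

lemma pythagoras:
  "(norm y)\<^sup>2 * (norm (x - sc c y))\<^sup>2 =
     (norm x)\<^sup>2 * (norm y)\<^sup>2 - (norm (h x y))\<^sup>2 + (norm (h x y - c * of_real ((norm y)\<^sup>2)))\<^sup>2"
    (is "?L = ?R")
proof -
  define H where "H = h x y"
  have H': "h y x = conjug H" by (simp add: H_def conj_sym)
  define Y where "Y = (of_real ((norm y)\<^sup>2) :: 'k)"
  have cY: "conjug Y = Y" unfolding Y_def by (rule conjug_of_real)
  have "of_real ?L = Y * h (x - sc c y) (x - sc c y)"
    by (simp add: self Y_def)
  also have "\<dots> = Y * (h x x - c * conjug H - conjug c * (H - c * Y))"
    by (simp add: diff_left diff_right scale_left scale_right H' H_def[symmetric] self[of y]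
        Y_def[symmetric] del: of_real_power)
  also have "\<dots> = h x x * Y - H * conjug H + (H - c * Y) * conjug (H - c * Y)"
    by (simp add: conjug_diff conjug_mult cY algebra_simps)
  also have "\<dots> = of_real ?R"
    unfolding mult_conjug_of_real by (simp add: self H_def Y_def)
  finally show ?thesis by (simp only: of_real_eq_iff)
qed

lemma projection_residual:
  assumes "y \<noteq> 0"
  shows "(norm y * norm (x - sc (h x y / of_real ((norm y)\<^sup>2)) y))\<^sup>2
    = (norm x)\<^sup>2 * (norm y)\<^sup>2 - (norm (h x y))\<^sup>2"
proof -
  have "h x y - h x y / of_real ((norm y)\<^sup>2) * of_real ((norm y)\<^sup>2) = 0"
    using assms by simp
  then show ?thesis
    using pythagoras[of y x "h x y / of_real ((norm y)\<^sup>2)"]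
    by (simp only: power_mult_distrib norm_zero) simp
qed

lemma Cauchy_Schwarz: "norm (h x y) \<le> norm x * norm y"
proof (cases "y = 0")
  case True
  have "h x 0 + h x 0 = h x 0" using add_right[of x 0 0] by simp
  then show ?thesis using True by simp
next
  case False
  have "(norm (h x y))\<^sup>2 \<le> (norm x * norm y)\<^sup>2"
    using projection_residual[OF False, of x] zero_le_power2[of "norm y * norm (x - sc (h x y / of_real ((norm y)\<^sup>2)) y)"]
    unfolding power_mult_distrib[of "norm x"] by linarith
  then show ?thesis by (rule power2_le_imp_le) simp
qed

lemma cos_bounds:
  assumes "x \<noteq> 0" "y \<noteq> 0"
  shows "0 \<le> norm (h x y) / (norm x * norm y)" "norm (h x y) / (norm x * norm y) \<le> 1"
  using Cauchy_Schwarz[of x y] assms by (simp_all add: divide_le_eq)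

lemma proj_dist_bounds:
  assumes "x \<noteq> 0" "y \<noteq> 0"
  shows "0 \<le> proj_dist h x y" "proj_dist h x y \<le> pi / 2"
proof -
  note b = cos_bounds[OF assms]
  show "0 \<le> proj_dist h x y"
    unfolding proj_dist_def by (rule arccos_lbound) (use b in linarith)+
  show "proj_dist h x y \<le> pi / 2"
    unfolding proj_dist_def by (rule arccos_le_pi2[OF b])
qed

lemma sin_proj_dist:
  assumes "x \<noteq> 0" "y \<noteq> 0"
  shows "(norm x * norm y * sin (proj_dist h x y))\<^sup>2 = (norm x)\<^sup>2 * (norm y)\<^sup>2 - (norm (h x y))\<^sup>2"
proof -
  define t where "t = norm (h x y) / (norm x * norm y)"
  have "cos (proj_dist h x y) = t"
    unfolding proj_dist_def t_def[symmetric]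
    by (rule cos_arccos) (use cos_bounds[OF assms, folded t_def] in linarith)+
  then have "(norm x * norm y * sin (proj_dist h x y))\<^sup>2 = (norm x * norm y)\<^sup>2 - (norm x * norm y * t)\<^sup>2"
    by (simp add: power_mult_distrib sin_squared_eq right_diff_distrib)
  also have "norm x * norm y * t = norm (h x y)"
    using assms by (simp add: t_def)
  finally show ?thesis by (simp add: power_mult_distrib)
qed

text \<open>
  The number \<^term>\<open>norm x * sin (proj_dist h x y)\<close> is the distance from \<^term>\<open>x\<close> to the line
  spanned by \<^term>\<open>y\<close>; this lemma and the next one are the two halves of that assertion.
\<close>

lemma sin_proj_dist_le:
  assumes "x \<noteq> 0" "y \<noteq> 0"
  shows "norm x * sin (proj_dist h x y) \<le> norm (x - sc c y)"
proof -
  have "(norm y * (norm x * sin (proj_dist h x y)))\<^sup>2 \<le> (norm y * norm (x - sc c y))\<^sup>2"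
    using sin_proj_dist[OF assms] pythagoras[of y x c] by (simp add: power_mult_distrib ac_simps)
  then have "norm y * (norm x * sin (proj_dist h x y)) \<le> norm y * norm (x - sc c y)"
    by (rule power2_le_imp_le) simp
  then show ?thesis using assms by simp
qed

lemma sin_proj_dist_attained:
  assumes "x \<noteq> 0" "y \<noteq> 0"
  obtains c where "norm (x - sc c y) = norm x * sin (proj_dist h x y)"
proof
  let ?c = "h x y / of_real ((norm y)\<^sup>2)"
  have "(norm y * norm (x - sc ?c y))\<^sup>2 = (norm y * (norm x * sin (proj_dist h x y)))\<^sup>2"
    unfolding projection_residual[OF assms(2)] sin_proj_dist[OF assms, symmetric]
    by (simp add: power_mult_distrib)
  moreover have "0 \<le> sin (proj_dist h x y)"
    using proj_dist_bounds[OF assms] by (intro sin_ge_zero) auto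
  ultimately have "norm y * norm (x - sc ?c y) = norm y * (norm x * sin (proj_dist h x y))"
    by (subst (asm) power2_eq_iff_nonneg) auto
  then show "norm (x - sc ?c y) = norm x * sin (proj_dist h x y)" using assms by simp
qed

end

interpretation vec_form: hermitian_form herm_prod "(*s)"
proof
  fix x y z :: "'k::conj_normed_field ^ 'n" and c :: 'k
  show "herm_prod (x + y) z = herm_prod x z + herm_prod y z"
    by (simp add: herm_prod_def distrib_right sum.distrib)
  show "herm_prod (c *s x) y = c * herm_prod x y"
    by (simp add: herm_prod_def sum_distrib_left mult.assoc)
  show "conjug (herm_prod x y) = herm_prod y x"
    by (simp add: herm_prod_def conjug_sum conjug_mult mult.commute)
  show "herm_prod x x = of_real ((norm x)\<^sup>2)" by (rule herm_prod_self)
qed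

lemma frob_prod_sum: "frob_prod A B = (\<Sum>i\<in>UNIV. \<Sum>j\<in>UNIV. A $ i $ j * conjug (B $ i $ j))"
proof -
  have "frob_prod A B = (\<Sum>j\<in>UNIV. \<Sum>i\<in>UNIV. A $ i $ j * conjug (B $ i $ j))"
    by (simp add: frob_prod_def trace_def conj_transpose_def matrix_matrix_mult_def mult.commute)
  then show ?thesis by (subst sum.swap)
qed

definition scale_pair ::
  "'k::conj_normed_field \<Rightarrow> ('k ^ 'n ^ 'n) \<times> 'k \<Rightarrow> ('k ^ 'n ^ 'n) \<times> 'k" where
  "scale_pair c = (\<lambda>(A, l). (\<chi> i. c *s A $ i, c * l))"

interpretation pair_form: hermitian_form pair_prod scale_pair
proof
  fix x y z :: "('k::conj_normed_field ^ 'n ^ 'n) \<times> 'k" and c :: 'k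
  show "pair_prod (x + y) z = pair_prod x z + pair_prod y z"
    by (cases x; cases y; cases z)
      (simp add: pair_prod_def frob_prod_sum distrib_right sum.distrib)
  show "pair_prod (scale_pair c x) y = c * pair_prod x y"
    by (cases x; cases y)
      (simp add: pair_prod_def scale_pair_def frob_prod_sum sum_distrib_left distrib_left mult.assoc)
  show "conjug (pair_prod x y) = pair_prod y x"
    by (cases x; cases y)
      (simp add: pair_prod_def frob_prod_sum conjug_sum conjug_add conjug_mult mult.commute)
  show "pair_prod x x = of_real ((norm x)\<^sup>2)" by (rule pair_prod_self)
qed

section \<open>Simple eigenvalues and the compression to the orthogonal complement\<close>

lemma poly_det:
  fixes P :: "'k::comm_ring_1 poly ^ 'n ^ 'n"
  shows "poly (det P) x = det (\<chi> i j. poly (P $ i $ j) x)"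
  by (simp add: det_def poly_sum poly_prod)

lemma poly_charpoly: "poly (charpoly A) x = det (mat x - A)"
proof -
  have "(\<chi> i j. poly ((mat [:0, 1:] - (\<chi> i j. [:A $ i $ j:])) $ i $ j) x) = mat x - A"
    by (simp add: vec_eq_iff mat_def)
  then show ?thesis by (simp add: charpoly_def poly_det)
qed

lemma mat_vector_mult: "mat x *v y = x *s (y :: 'k::comm_ring_1 ^ 'n)"
  by (simp add: vec_eq_iff matrix_vector_mult_def mat_def if_distrib[of "\<lambda>c. c * _"] cong: if_cong)

lemma det_nonzero_iff:
  fixes M :: "'k::field ^ 'n ^ 'n"
  shows "det M \<noteq> 0 \<longleftrightarrow> (\<forall>y. M *v y = 0 \<longrightarrow> y = 0)"
  using invertible_det_nz invertible_left_inverse matrix_left_invertible_ker by metis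

definition replace_column :: "'n \<Rightarrow> 'k ^ 'm \<Rightarrow> 'k ^ 'n ^ 'm \<Rightarrow> 'k ^ 'n ^ 'm" where
  "replace_column k v M = (\<chi> i j. if j = k then v $ i else M $ i $ j)"

lemma det_replace_column_scale:
  fixes M :: "'k::comm_ring_1 ^ 'n ^ 'n"
  shows "det (replace_column k (c *s v) M) = c * det (replace_column k v M)"
proof -
  have tr: "transpose (replace_column k u M) = (\<chi> i. if i = k then u else column i M)" for u
    by (simp add: vec_eq_iff transpose_def replace_column_def column_def)
  have "det (transpose (replace_column k (c *s v) M)) = c * det (transpose (replace_column k v M))"
    unfolding tr using det_row_mul[of k c "\<lambda>_. v" "\<lambda>i. column i M"] .
  then show ?thesis by (simp add: det_transpose)
qed

lemma replace_column_mult: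
  fixes M :: "'k::comm_ring_1 ^ 'n ^ 'm"
  shows "replace_column k v M *v y = M *v (y - y $ k *s axis k 1) + y $ k *s v"
proof -
  have "(\<Sum>j\<in>UNIV. (if j = k then v $ i else M $ i $ j) * y $ j)
      = (\<Sum>j\<in>UNIV. M $ i $ j * (y $ j - y $ k * axis k 1 $ j)) + y $ k * v $ i" for i
  proof -
    have "(\<Sum>j\<in>UNIV. (if j = k then v $ i else M $ i $ j) * y $ j)
        = (\<Sum>j\<in>UNIV. M $ i $ j * (y $ j - y $ k * axis k 1 $ j) + (if j = k then y $ k * v $ i else 0))"
      by (intro sum.cong) (auto simp: axis_def)
    then show ?thesis by (simp add: sum.distrib)
  qed
  then show ?thesis by (simp add: vec_eq_iff matrix_vector_mult_def replace_column_def)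
qed

text \<open>
  Up to the factor \<^term>\<open>v $ k\<close>, this is the quotient of the characteristic polynomial by the linear
  factor of an eigenvalue with eigenvector \<^term>\<open>v\<close>.
\<close>

definition replaced_column_poly :: "'n \<Rightarrow> 'k ^ 'n \<Rightarrow> 'k::field ^ 'n ^ 'n \<Rightarrow> 'k poly" where
  "replaced_column_poly k v A = det (replace_column k (\<chi> i. [:v $ i:]) (mat [:0, 1:] - (\<chi> i j. [:A $ i $ j:])))"

lemma poly_replaced_column: "poly (replaced_column_poly k v A) x = det (replace_column k v (mat x - A))"
proof -
  have "(\<chi> i j. poly (replace_column k (\<chi> i. [:v $ i:]) (mat [:0, 1:] - (\<chi> i j. [:A $ i $ j:])) $ i $ j) x)
     = replace_column k v (mat x - A)"
    by (simp add: vec_eq_iff mat_def replace_column_def)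
  then show ?thesis by (simp add: replaced_column_poly_def poly_det)
qed

text \<open>
  Cramer's rule: as \<^term>\<open>(mat x - A) *v v = (x - l) *s v\<close>, putting \<^term>\<open>(x - l) *s v\<close> in
  place of the \<^term>\<open>k\<close>-th column multiplies the determinant by \<^term>\<open>v $ k\<close>. This splits
  off a linear factor of the characteristic polynomial without a change of basis. Cramer's rule
  holds over a field, so it is applied at every point \<^term>\<open>x\<close>, and the polynomials agree
  because the field is infinite.
\<close>

lemma charpoly_factor:
  fixes A :: "'k::field_char_0 ^ 'n ^ 'n"
  assumes "(mat l - A) *v v = 0"
  shows "smult (v $ k) (charpoly A) = [:- l, 1:] * replaced_column_poly k v A"
proof -
  have "poly (smult (v $ k) (charpoly A)) x = poly ([:- l, 1:] * replaced_column_poly k v A) x" for x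
  proof -
    have "(mat x - A) *v v = (mat x - A) *v v - (mat l - A) *v v" using assms by simp
    also have "\<dots> = (x - l) *s v"
      by (simp add: matrix_vector_mult_diff_rdistrib mat_vector_mult vector_sub_rdistrib)
    finally have Mv: "(mat x - A) *v v = (x - l) *s v" .
    have "v $ k * det (mat x - A) = det (replace_column k ((mat x - A) *v v) (mat x - A))"
      unfolding replace_column_def by (rule cramer_lemma[symmetric])
    also have "\<dots> = (x - l) * det (replace_column k v (mat x - A))"
      unfolding Mv by (rule det_replace_column_scale)
    finally show ?thesis by (simp add: poly_charpoly poly_replaced_column left_diff_distrib)
  qed
  then show ?thesis by (simp add: poly_eq_poly_eq_iff[symmetric] fun_eq_iff)
qed

lemma norm_matrix_vector_mult_le:
  fixes A :: "'k::real_normed_field ^ 'n ^ 'm"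
  shows "norm (A *v x) \<le> norm A * norm x"
proof -
  have row: "norm ((A *v x) $ i) \<le> norm (A $ i) * norm x" for i
  proof -
    have "norm ((A *v x) $ i) \<le> (\<Sum>j\<in>UNIV. \<bar>norm (A $ i $ j)\<bar> * \<bar>norm (x $ j)\<bar>)"
      unfolding matrix_vector_mult_def using norm_sum[of "\<lambda>j. A $ i $ j * x $ j" UNIV]
      by (simp add: norm_mult)
    also have "\<dots> \<le> norm (A $ i) * norm x"
      unfolding norm_vec_def by (rule L2_set_mult_ineq)
    finally show ?thesis .
  qed
  have "norm (A *v x) \<le> L2_set (\<lambda>i. norm x * norm (A $ i)) UNIV"
    unfolding norm_vec_def[of "A *v x"] using row by (intro L2_set_mono) (simp_all add: mult.commute)
  also have "\<dots> = norm A * norm x"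
    unfolding norm_vec_def[of A] by (simp add: L2_set_right_distrib[symmetric] mult.commute)
  finally show ?thesis .
qed

lemma norm_vector_scalar_mult: "norm (c *s x) = norm c * norm (x :: 'k::real_normed_field ^ 'n)"
  by (simp add: norm_vec_def norm_mult L2_set_right_distrib)

text \<open>
  The order of the zero polynomial is unspecified, so this is needed before any statement about
  multiplicities. A scalar larger than the Frobenius norm is not an eigenvalue.
\<close>

lemma charpoly_nonzero: "charpoly (A :: 'k::real_normed_field ^ 'n ^ 'n) \<noteq> 0"
proof -
  define x :: 'k where "x = of_real (norm A + 1)"
  have nx: "norm x > norm A" unfolding x_def norm_of_real using norm_ge_zero[of A] by linarith
  have "y = 0" if "(mat x - A) *v y = 0" for y
  proof (rule ccontr)
    assume "y \<noteq> 0"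
    have "x *s y = A *v y" using that by (simp add: matrix_vector_mult_diff_rdistrib mat_vector_mult)
    then have "norm x * norm y \<le> norm A * norm y"
      using norm_matrix_vector_mult_le[of A y] by (simp add: norm_vector_scalar_mult[symmetric])
    then show False using nx \<open>y \<noteq> 0\<close> by simp
  qed
  then have "poly (charpoly A) x \<noteq> 0" by (simp add: poly_charpoly det_nonzero_iff)
  then show ?thesis by auto
qed

text \<open>
  One factor \<^term>\<open>[:- l, 1:]\<close> splits off by \<open>charpoly_factor\<close>, so the eigenvalue is simple if and
  only if the cofactor does not vanish at \<^term>\<open>l\<close>.
\<close>

lemma order_charpoly_iff:
  fixes A :: "'k::real_normed_field ^ 'n ^ 'n"
  assumes "(mat l - A) *v v = 0" and vk: "v $ k \<noteq> 0"
  shows "order l (charpoly A) = 1 \<longleftrightarrow> det (replace_column k v (mat l - A)) \<noteq> 0"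
proof -
  have fac: "smult (v $ k) (charpoly A) = [:- l, 1:] * replaced_column_poly k v A"
    by (rule charpoly_factor[OF assms(1)])
  have nz: "[:- l, 1:] * replaced_column_poly k v A \<noteq> 0"
    unfolding fac[symmetric] using vk charpoly_nonzero by simp
  have "order l (charpoly A) = order l ([:- l, 1:] * replaced_column_poly k v A)"
    unfolding fac[symmetric] by (rule order_smult[OF vk, symmetric])
  also have "\<dots> = 1 + order l (replaced_column_poly k v A)"
    unfolding order_mult[OF nz] using order_power_n_n[of l 1] by simp
  finally have "order l (charpoly A) = 1 + order l (replaced_column_poly k v A)" .
  moreover have "replaced_column_poly k v A \<noteq> 0" using nz by auto
  ultimately show ?thesis using order_root[of "replaced_column_poly k v A" l] by (auto simp: poly_replaced_column)
qed

lemma herm_prod_self_eq_0: "herm_prod v v = 0 \<longleftrightarrow> v = 0"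
  by (simp add: herm_prod_self)

lemma proj_perp_mem: "v \<noteq> 0 \<Longrightarrow> proj_perp v x \<in> perp v"
  by (simp add: perp_def proj_perp_def vec_form.diff_left vec_form.scale_left herm_prod_self_eq_0)

lemma proj_perp_add: "proj_perp v (x + y) = proj_perp v x + proj_perp v y"
  by (simp add: proj_perp_def vec_form.add_left add_divide_distrib vector_sadd_rdistrib)

lemma proj_perp_scale: "proj_perp v (c *s x) = c *s proj_perp v x"
  by (simp add: proj_perp_def vec_form.scale_left vec_eq_iff algebra_simps)

lemma proj_perp_diff: "proj_perp v (x - y) = proj_perp v x - proj_perp v y"
  using proj_perp_add[of v "x - y" y] by (simp add: algebra_simps)

lemma proj_perp_self: "v \<noteq> 0 \<Longrightarrow> proj_perp v v = 0"
  by (simp add: proj_perp_def herm_prod_self_eq_0)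

lemma norm_proj_perp_le:
  assumes "v \<noteq> 0"
  shows "norm (proj_perp v x) \<le> norm x"
proof -
  have "(norm v * norm (proj_perp v x))\<^sup>2 \<le> (norm v * norm x)\<^sup>2"
    using vec_form.projection_residual[OF assms, of x]
    by (simp add: proj_perp_def herm_prod_self power_mult_distrib)
  then have "norm v * norm (proj_perp v x) \<le> norm v * norm x"
    by (rule power2_le_imp_le) simp
  then show ?thesis using assms by simp
qed

lemma scaleR_eq_scalar_mult: "r *\<^sub>R x = of_real r *s (x :: 'k::real_normed_field ^ 'n)"
  by (simp add: vec_eq_iff scaleR_conv_of_real[of r "x $ _"])

lemma linear_perp_op: "linear (perp_op A l v)"
proof (rule linearI)
  show "perp_op A l v (x + y) = perp_op A l v x + perp_op A l v y" for x y
    unfolding perp_op_def by (simp add: matrix_vector_right_distrib proj_perp_add)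
  show "perp_op A l v (r *\<^sub>R x) = r *\<^sub>R perp_op A l v x" for r x
    unfolding perp_op_def scaleR_eq_scalar_mult by (simp add: vector_scalar_commute proj_perp_scale)
qed

lemma subspace_perp: "subspace (perp v)"
proof -
  have "herm_prod 0 v = 0" by (simp add: herm_prod_def)
  then show ?thesis
    by (auto simp: subspace_def perp_def vec_form.add_left scaleR_eq_scalar_mult vec_form.scale_left)
qed

text \<open>
  Injectivity on \<^term>\<open>perp v\<close> gives surjectivity by counting real dimensions.
\<close>

lemma bij_betw_perp_op:
  assumes "v \<noteq> 0" and inj: "\<forall>w\<in>perp v. perp_op A l v w = 0 \<longrightarrow> w = 0"
  shows "bij_betw (perp_op A l v) (perp v) (perp v)"
proof -
  have inj_on: "inj_on (perp_op A l v) (perp v)"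
    using inj linear_inj_on_iff_eq_0[OF linear_perp_op subspace_perp] by blast
  have "perp_op A l v ` perp v = perp v"
  proof (rule subspace_dim_equal)
    show "subspace (perp_op A l v ` perp v)"
      by (rule linear_subspace_image[OF linear_perp_op subspace_perp])
    show "perp_op A l v ` perp v \<subseteq> perp v"
      using proj_perp_mem[OF assms(1)] by (auto simp: perp_op_def)
    have "dim (perp_op A l v ` perp v) = dim (perp v)"
      using inj_on by (intro dim_image_eq linear_perp_op) (simp add: span_eq_iff[THEN iffD2, OF subspace_perp])
    then show "dim (perp v) \<le> dim (perp_op A l v ` perp v)" by simp
  qed (rule subspace_perp)
  then show ?thesis using inj_on by (simp add: bij_betw_def)
qed

text \<open>
  Choose a coordinate \<^term>\<open>k\<close> in which \<^term>\<open>v\<close> does not vanish. The vectors orthogonal to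
  \<^term>\<open>v\<close> and the vectors with vanishing \<^term>\<open>k\<close>-th coordinate are two complements of the
  line of \<^term>\<open>v\<close>, and \<^term>\<open>mat l - A\<close> kills that line. So the compression to the first
  complement and the matrix with \<^term>\<open>v\<close> as its \<^term>\<open>k\<close>-th column both have a trivial kernel
  exactly if \<^term>\<open>mat l - A\<close> maps no vector outside the line of \<^term>\<open>v\<close> into it. The
  determinant of that matrix decides the multiplicity, by \<open>order_charpoly_iff\<close>.
\<close>

lemma simple_eigenvalue_iff:
  fixes v :: "'k::conj_normed_field ^ 'n"
  assumes eig: "(mat l - A) *v v = 0" and v: "v \<noteq> 0"
  shows "order l (charpoly A) = 1 \<longleftrightarrow> (\<forall>w\<in>perp v. perp_op A l v w = 0 \<longrightarrow> w = 0)"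
proof -
  define B where "B = mat l - A"
  have Bv: "B *v v = 0" using eig by (simp add: B_def)
  obtain k where k: "v $ k \<noteq> 0" using v by (auto simp: vec_eq_iff)
  have "order l (charpoly A) = 1 \<longleftrightarrow> (\<forall>y. replace_column k v B *v y = 0 \<longrightarrow> y = 0)"
    using order_charpoly_iff[OF eig k] by (simp add: det_nonzero_iff B_def)
  also have "\<dots> \<longleftrightarrow> (\<forall>w\<in>perp v. perp_op A l v w = 0 \<longrightarrow> w = 0)"
  proof (intro iffI ballI allI impI)
    fix w assume inj: "\<forall>y. replace_column k v B *v y = 0 \<longrightarrow> y = 0"
      and w: "w \<in> perp v" and Tw: "perp_op A l v w = 0"
    define b where "b = herm_prod (B *v w) v / herm_prod v v"
    define a where "a = w $ k / v $ k"
    have Bw: "B *v w = b *s v"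
      using Tw by (simp add: perp_op_def proj_perp_def B_def b_def)
    \<comment> \<open>\<^term>\<open>w - a *s v\<close> has a vanishing \<^term>\<open>k\<close>-th coordinate; the last summand makes the new
        column contribute \<^term>\<open>- b *s v\<close>\<close>
    define y where "y = w - a *s v - b *s axis k 1"
    have yk: "y $ k = - b" using k by (simp add: y_def a_def)
    have "replace_column k v B *v y = B *v (w - a *s v) - b *s v"
      unfolding replace_column_mult yk by (simp add: y_def vec_eq_iff)
    also have "\<dots> = 0"
      by (simp add: matrix_vector_mult_diff_distrib vector_scalar_commute Bv Bw)
    finally have y0: "y = 0" using inj by blast
    then have "b = 0" using yk by simp
    then have wa: "w = a *s v" using y0 by (simp add: y_def)
    then have "a * herm_prod v v = 0" using w by (simp add: perp_def vec_form.scale_left)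
    then show "w = 0" using wa v by (simp add: herm_prod_self_eq_0)
  next
    fix y assume inj: "\<forall>w\<in>perp v. perp_op A l v w = 0 \<longrightarrow> w = 0"
      and y: "replace_column k v B *v y = 0"
    define z where "z = y - y $ k *s axis k 1"
    define a where "a = herm_prod z v / herm_prod v v"
    have zk: "z $ k = 0" by (simp add: z_def)
    have "B *v z + y $ k *s v = 0" using y by (simp add: replace_column_mult z_def)
    then have Bz: "B *v z = (- (y $ k)) *s v" by (simp add: eq_neg_iff_add_eq_0)
    have pz: "proj_perp v z = z - a *s v" by (simp add: proj_perp_def a_def)
    have "perp_op A l v (proj_perp v z) = proj_perp v ((- (y $ k)) *s v)"
      unfolding perp_op_def B_def[symmetric] pz
      by (simp add: matrix_vector_mult_diff_distrib vector_scalar_commute Bv Bz)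
    also have "\<dots> = 0" unfolding proj_perp_scale by (simp add: proj_perp_self[OF v])
    finally have "z = a *s v" using inj proj_perp_mem[OF v, of z] pz by auto
    then have z0: "z = 0" using zk k by auto
    then have "y $ k *s v = 0" using Bz by simp
    then have "y $ k = 0" using v by simp
    then show "y = 0" using z0 by (simp add: z_def)
  qed
  finally show ?thesis .
qed

section \<open>The distance to the ill-posed triples over the same eigenvector\<close>

text \<open>
  The last component of a triple in the fibre may be any multiple of \<^term>\<open>v\<close>; neither the
  orthogonal complement nor the compression depends on the multiple.
\<close>

lemma ill_posed_fibreD:
  fixes A :: "'k::conj_normed_field ^ 'n ^ 'n"
  assumes "(A, l, w) \<in> ill_posed \<inter> fibre v" "v \<noteq> 0"
  obtains u where "u \<in> perp v" "u \<noteq> 0" "perp_op A l v u = 0"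
proof -
  obtain c where w: "w = c *s v" and c: "c \<noteq> 0"
    using assms(1) by (auto simp: fibre_def proj_eq_def)
  have "(mat l - A) *v w = 0" and "order l (charpoly A) \<noteq> 1"
    using assms(1) by (auto simp: ill_posed_def solution_variety_def well_posed_def)
  moreover from this c have "(mat l - A) *v v = 0" by (simp add: w vector_scalar_commute)
  ultimately show ?thesis using simple_eigenvalue_iff[of l A v] assms(2) that by blast
qed

text \<open>
  The compression of \<^term>\<open>c *s ((mat l' - A') *v u)\<close> vanishes with that of
  \<^term>\<open>(mat l' - A') *v u\<close>, so
  it may be subtracted: up to a projection, \<^term>\<open>perp_op A l v u\<close> is the difference of the two
  pairs applied to \<^term>\<open>u\<close>. The factor 2 accounts for the matrix and the scalar part.
\<close>

lemma perp_op_perturbation: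
  fixes A A' :: "'k::conj_normed_field ^ 'n ^ 'n"
  assumes v: "v \<noteq> 0" and u: "perp_op A' l' v u = 0"
  shows "norm (perp_op A l v u) \<le> 2 * norm ((A, l) - scale_pair c (A', l')) * norm u"
proof -
  define D where "D = A - (\<chi> i. c *s A' $ i)"
  define m where "m = l - c * l'"
  have pair: "(A, l) - scale_pair c (A', l') = (D, m)"
    by (simp add: scale_pair_def D_def m_def)
  have cA': "(\<chi> i. c *s A' $ i) *v u = c *s (A' *v u)"
    by (simp add: vec_eq_iff matrix_vector_mult_def sum_distrib_left mult.assoc)
  have split: "(mat l - A) *v u - c *s ((mat l' - A') *v u) = m *s u - D *v u"
    by (simp add: D_def m_def matrix_vector_mult_diff_rdistrib mat_vector_mult cA' vec_eq_iff algebra_simps)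
  have "perp_op A l v u = proj_perp v ((mat l - A) *v u) - c *s proj_perp v ((mat l' - A') *v u)"
    using u by (simp add: perp_op_def)
  also have "\<dots> = proj_perp v (m *s u - D *v u)"
    by (simp only: proj_perp_scale[symmetric] proj_perp_diff[symmetric] split)
  finally have "norm (perp_op A l v u) \<le> norm (m *s u - D *v u)"
    using norm_proj_perp_le[OF v] by simp
  also have "\<dots> \<le> norm m * norm u + norm D * norm u"
    using norm_triangle_ineq4[of "m *s u" "D *v u"] norm_matrix_vector_mult_le[of D u]
    by (simp add: norm_vector_scalar_mult)
  also have "\<dots> \<le> norm (D, m) * norm u + norm (D, m) * norm u"
    using norm_fst_le[of D m] norm_snd_le[of m D] by (intro add_mono mult_right_mono) auto
  finally show ?thesis unfolding pair by (simp add: mult_ac)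
qed

text \<open>
  This makes the sine in the theorem positive; if the distance were zero, the quotient by its sine
  would be zero and the bound could fail. The compression at the well-posed triple
  is bounded from below, say by \<^term>\<open>e\<close>, and that of an ill-posed triple has a kernel. So the
  given pair stays away from the lines spanned by the ill-posed pairs.
\<close>

lemma ill_posed_fibre_bounded_away:
  fixes A :: "'k::conj_normed_field ^ 'n ^ 'n"
  assumes "(A, l, v) \<in> well_posed"
  obtains d where "d > 0" "\<And>t. t \<in> ill_posed \<inter> fibre v \<Longrightarrow> d \<le> proj2_dist (A, l, v) t"
proof -
  have Al: "(A, l) \<noteq> 0" and v: "v \<noteq> 0" and eig: "(mat l - A) *v v = 0"
    and simple: "order l (charpoly A) = 1"
    using assms by (auto simp: well_posed_def solution_variety_def)
  have inj: "\<forall>w\<in>perp v. perp_op A l v w = 0 \<longrightarrow> w = 0"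
    using simple simple_eigenvalue_iff[OF eig v] by simp
  obtain e where e: "e > 0" "\<And>w. w \<in> perp v \<Longrightarrow> e * norm w \<le> norm (perp_op A l v w)"
    using injective_imp_isometric[OF closed_subspace[OF subspace_perp] subspace_perp _ inj]
      linear_perp_op linear_conv_bounded_linear by blast
  have nAl: "norm (A, l) > 0" using Al zero_less_norm_iff by blast
  define d where "d = e / (2 * norm (A, l))"
  have "d \<le> proj2_dist (A, l, v) t" if t: "t \<in> ill_posed \<inter> fibre v" for t
  proof -
    obtain A' l' w where t': "t = (A', l', w)" by (cases t)
    have Al': "(A', l') \<noteq> 0" using t by (auto simp: t' ill_posed_def solution_variety_def)
    obtain u where u: "u \<in> perp v" "u \<noteq> 0" "perp_op A' l' v u = 0"
      using ill_posed_fibreD[OF _ v] t t' by blast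
    let ?\<theta> = "proj_dist pair_prod (A, l) (A', l')"
    \<comment> \<open>scale the representative of the ill-posed pair to the orthogonal projection of the given pair\<close>
    obtain c where c: "norm ((A, l) - scale_pair c (A', l')) = norm (A, l) * sin ?\<theta>"
      using pair_form.sin_proj_dist_attained[OF Al Al'] by blast
    have "e * norm u \<le> 2 * (norm (A, l) * sin ?\<theta>) * norm u"
      using e(2)[OF u(1)] perp_op_perturbation[OF v u(3), of A l c] unfolding c by linarith
    then have "e \<le> 2 * norm (A, l) * sin ?\<theta>" using u(2) by (simp add: mult.assoc)
    then have "d \<le> sin ?\<theta>"
      unfolding d_def using nAl by (simp add: pos_divide_le_eq mult.commute)
    also have "\<dots> \<le> ?\<theta>" by (rule sin_x_le_x) (rule pair_form.proj_dist_bounds(1)[OF Al Al'])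
    also have "\<dots> \<le> proj2_dist (A, l, v) t"
      unfolding t' proj2_dist_def by (auto intro: real_le_rsqrt)
    finally show ?thesis .
  qed
  moreover have "d > 0" using e(1) nAl by (simp add: d_def)
  ultimately show ?thesis using that by blast
qed

definition rank_one :: "'k::conj_normed_field ^ 'n \<Rightarrow> 'k ^ 'n \<Rightarrow> 'k ^ 'n ^ 'n" where
  "rank_one w x = (\<chi> i j. w $ i * conjug (x $ j))"

lemma rank_one_mult: "rank_one w x *v y = herm_prod y x *s w"
  by (simp add: rank_one_def vec_eq_iff matrix_vector_mult_def herm_prod_def sum_distrib_left mult_ac)

lemma norm_rank_one: "norm (rank_one w x) = norm w * norm x"
proof -
  have "norm (rank_one w x $ i) = norm x * norm (w $ i)" for i
    by (simp add: rank_one_def norm_vec_def norm_mult L2_set_right_distrib mult.commute)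
  then show ?thesis
    unfolding norm_vec_def[of "rank_one w x"] norm_vec_def[of w]
    by (simp add: L2_set_right_distrib mult.commute)
qed

lemma proj_dist_herm_self: "v \<noteq> 0 \<Longrightarrow> proj_dist herm_prod v v = 0"
  by (simp add: proj_dist_def herm_prod_self power2_eq_square norm_mult)

text \<open>
  Subtracting from the compression the rank-one map that sends \<^term>\<open>x\<close> to \<^term>\<open>w\<close> puts
  \<^term>\<open>x\<close> into its kernel. As \<^term>\<open>x\<close> is orthogonal to \<^term>\<open>v\<close>, the
  corresponding change of \<^term>\<open>A\<close> keeps \<^term>\<open>v\<close> as an eigenvector for \<^term>\<open>l\<close>. The perturbed triple is
  ill-posed, and its distance to the given one is an angle whose sine is at most the relative size
  of the perturbation.

  The hypothesis \<open>nz\<close> ensures that the perturbed triple is a point of the projective space: for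
  \<^term>\<open>l = 0\<close> and a matrix \<^term>\<open>A\<close> of rank one the perturbed matrix can vanish.
\<close>

lemma sin_setdist_le:
  fixes A :: "'k::conj_normed_field ^ 'n ^ 'n"
  assumes wp: "(A, l, v) \<in> well_posed"
    and x: "x \<in> perp v" "x \<noteq> 0" and Tx: "perp_op A l v x = w"
    and nz: "norm A * norm x \<noteq> norm w"
  defines "d \<equiv> proj2_setdist (A, l, v) (ill_posed \<inter> fibre v)"
  shows "0 < sin d" "norm (A, l) * sin d \<le> norm w / norm x"
proof -
  have Al: "(A, l) \<noteq> 0" and v: "v \<noteq> 0" and eig: "(mat l - A) *v v = 0"
    using wp by (auto simp: well_posed_def solution_variety_def)
  define E where "E = rank_one ((1 / (norm x)\<^sup>2) *\<^sub>R w) x"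
  have normE: "norm E = norm w / norm x"
    using x(2) by (simp add: E_def norm_rank_one power2_eq_square)
  have "(norm x)\<^sup>2 * (1 / (norm x)\<^sup>2) = 1" using x(2) by simp
  then have Ex: "E *v x = w"
    unfolding E_def rank_one_mult scaleR_eq_scalar_mult
    by (simp only: vector_smult_assoc herm_prod_self of_real_mult[symmetric] of_real_1 vector_smult_lid)
  have "herm_prod v x = 0"
    using x(1) vec_form.conj_sym[of x v] by (simp add: perp_def)
  then have Ev: "E *v v = 0" by (simp add: E_def rank_one_mult)
  define A' where "A' = A + E"
  have eig': "(mat l - A') *v v = 0"
    using eig Ev by (simp add: A'_def matrix_vector_mult_diff_rdistrib matrix_vector_mult_add_rdistrib)
  have "w \<in> perp v" using proj_perp_mem[OF v] by (simp add: Tx[symmetric] perp_op_def)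
  then have "proj_perp v w = w" by (simp add: proj_perp_def perp_def)
  moreover have "(mat l - A') *v x = (mat l - A) *v x - w"
    using Ex by (simp add: A'_def matrix_vector_mult_diff_rdistrib matrix_vector_mult_add_rdistrib)
  ultimately have "perp_op A' l v x = 0"
    using Tx by (simp add: perp_op_def proj_perp_diff)
  then have mult: "order l (charpoly A') \<noteq> 1"
    using simple_eigenvalue_iff[OF eig' v] x by blast
  have Al': "(A', l) \<noteq> 0"
  proof
    assume "(A', l) = 0"
    then have "A = - E" by (simp add: A'_def eq_neg_iff_add_eq_0 zero_prod_def)
    then show False using nz normE x(2) by simp
  qed
  have "proj_eq v v" unfolding proj_eq_def by (intro exI[of _ 1]) simp
  then have mem: "(A', l, v) \<in> ill_posed \<inter> fibre v"
    using Al' v eig' mult by (auto simp: ill_posed_def fibre_def solution_variety_def well_posed_def)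
  obtain b where b: "b > 0" "\<And>t. t \<in> ill_posed \<inter> fibre v \<Longrightarrow> b \<le> proj2_dist (A, l, v) t"
    using ill_posed_fibre_bounded_away[OF wp] by blast
  have "b \<le> d" unfolding d_def proj2_setdist_def
    using mem b(2) by (intro cINF_greatest) auto
  then have "d > 0" using b(1) by linarith
  let ?\<theta> = "proj_dist pair_prod (A, l) (A', l)"
  note \<theta> = pair_form.proj_dist_bounds[OF Al Al']
  \<comment> \<open>both triples have the same last component, so only the first angle contributes\<close>
  have "d \<le> proj2_dist (A, l, v) (A', l, v)"
    unfolding d_def proj2_setdist_def
    using mem b(2) by (intro cINF_lower bdd_belowI2[of _ b]) auto
  also have "\<dots> = ?\<theta>" using \<theta>(1) v by (simp add: proj2_dist_def proj_dist_herm_self)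
  finally have d\<theta>: "d \<le> ?\<theta>" .
  show "0 < sin d" using \<open>d > 0\<close> d\<theta> \<theta>(2) pi_gt_zero by (intro sin_gt_zero) linarith+
  have "sin d \<le> sin ?\<theta>" using \<open>d > 0\<close> d\<theta> \<theta>(2) by (intro sin_monotone_2pi_le) auto
  then have "norm (A, l) * sin d \<le> norm (A, l) * sin ?\<theta>" by (rule mult_left_mono) simp
  also have "\<dots> \<le> norm ((A, l) - scale_pair 1 (A', l))"
    by (rule pair_form.sin_proj_dist_le[OF Al Al'])
  also have "(A, l) - scale_pair 1 (A', l) = (- E, 0)"
    by (simp add: scale_pair_def A'_def vec_eq_iff)
  also have "norm (- E, 0 :: 'k) = norm w / norm x" using normE by (simp add: norm_Pair)
  finally show "norm (A, l) * sin d \<le> norm w / norm x" .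
qed

lemma well_posed_matrix_nonzero:
  assumes "(A, l, v) \<in> well_posed"
  shows "A \<noteq> 0"
proof
  assume "A = 0"
  moreover have "(A, l) \<noteq> 0" "v \<noteq> 0" "(mat l - A) *v v = 0"
    using assms by (auto simp: well_posed_def solution_variety_def)
  ultimately show False by (simp add: mat_vector_mult zero_prod_def)
qed

text \<open>
  The norm of the inverse is a supremum of quotients \<^term>\<open>norm x / norm w\<close>, where the
  compression maps \<^term>\<open>x\<close> to \<^term>\<open>w\<close>, and each quotient is bounded by a perturbation
  of its own. The factor with the square root equals
  \<^term>\<open>norm A / norm (A, l)\<close>.
\<close>

lemma cond_number_le:
  fixes A :: "'k::conj_normed_field ^ 'n ^ 'n"
  assumes wp: "(A, l, v) \<in> well_posed"
  shows "cond_number (A, l, v) \<le>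
    max 1 (1 / sqrt (1 + (norm l)\<^sup>2 / (norm A)\<^sup>2) *
           (1 / sin (proj2_setdist (A, l, v) (ill_posed \<inter> fibre v))))"
    (is "_ \<le> max 1 ?R")
proof -
  let ?T = "perp_op A l v" and ?d = "proj2_setdist (A, l, v) (ill_posed \<inter> fibre v)"
  have v: "v \<noteq> 0" and eig: "(mat l - A) *v v = 0" and simple: "order l (charpoly A) = 1"
    using wp by (auto simp: well_posed_def solution_variety_def)
  have A: "norm A > 0" using well_posed_matrix_nonzero[OF wp] by simp
  have bij: "bij_betw ?T (perp v) (perp v)"
    using simple simple_eigenvalue_iff[OF eig v] bij_betw_perp_op[OF v] by blast
  have "1 + (norm l)\<^sup>2 / (norm A)\<^sup>2 = (norm (A, l) / norm A)\<^sup>2"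
    using A by (simp add: norm_Pair power_divide field_simps)
  then have R: "?R = norm A / norm (A, l) * (1 / sin ?d)" by simp
  have "norm (inv_into (perp v) ?T w) / norm w \<le> max 1 ?R / norm A" if w: "w \<in> perp v" for w
  proof -
    define x where "x = inv_into (perp v) ?T w"
    have x: "x \<in> perp v" "?T x = w"
      using bij w by (auto simp: x_def bij_betw_def inv_into_into f_inv_into_f)
    have "norm A * (norm x / norm w) \<le> max 1 ?R"
    \<comment> \<open>the quotient is zero in the first two cases and \<^term>\<open>1 / norm A\<close> in the third, where the
        perturbed triple may fail to exist and the maximum with 1 is what gives the bound\<close>
    proof (cases "norm w = 0 \<or> norm x = 0 \<or> norm A * norm x = norm w")
      case True
      then show ?thesis by auto
    next
      case False
      note * = sin_setdist_le[OF wp x(1) _ x(2)]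
      have "norm (A, l) * sin ?d \<le> norm w / norm x" "0 < sin ?d" using * False by auto
      moreover have "norm (A, l) > 0" using A by (simp add: zero_prod_def)
      ultimately have "norm x / norm w \<le> 1 / (norm (A, l) * sin ?d)"
        using False by (simp add: field_simps)
      then have "norm A * (norm x / norm w) \<le> norm A * (1 / (norm (A, l) * sin ?d))"
        by (rule mult_left_mono) simp
      also have "\<dots> = ?R" unfolding R by simp
      finally show ?thesis by simp
    qed
    then show ?thesis using A by (simp add: x_def pos_le_divide_eq mult.commute)
  qed
  moreover have "perp v \<noteq> {}" using subspace_0[OF subspace_perp] by blast
  ultimately have "onorm_on (perp v) (inv_into (perp v) ?T) \<le> max 1 ?R / norm A"
    unfolding onorm_on_def by (intro cSUP_least) auto
  then have "norm A * onorm_on (perp v) (inv_into (perp v) ?T) \<le> max 1 ?R"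
    using A by (simp only: pos_le_divide_eq mult.commute)
  then show ?thesis by (simp add: cond_number_def)
qed

theorem theorem1:
  assumes "CARD('n::finite) \<ge> 2"
  shows "(\<forall>(A :: real ^ 'n ^ 'n) (l :: real) (v :: real ^ 'n). (A, l, v) \<in> well_posed \<longrightarrow>
            cond_number (A, l, v) \<le>
              max 1 (1 / sqrt (1 + \<bar>l\<bar>\<^sup>2 / (norm A)\<^sup>2) *
                     (1 / sin (proj2_setdist (A, l, v) (ill_posed \<inter> fibre v)))))
       \<and> (\<forall>(A :: complex ^ 'n ^ 'n) (l :: complex) (v :: complex ^ 'n). (A, l, v) \<in> well_posed \<longrightarrow>
            cond_number (A, l, v) \<le>
              max 1 (1 / sqrt (1 + (cmod l)\<^sup>2 / (norm A)\<^sup>2) *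
                     (1 / sin (proj2_setdist (A, l, v) (ill_posed \<inter> fibre v)))))"
proof (intro conjI allI impI)
  fix A :: "real ^ 'n ^ 'n" and l :: real and v :: "real ^ 'n"
  assume "(A, l, v) \<in> well_posed"
  from cond_number_le[OF this]
  show "cond_number (A, l, v) \<le>
      max 1 (1 / sqrt (1 + \<bar>l\<bar>\<^sup>2 / (norm A)\<^sup>2) *
             (1 / sin (proj2_setdist (A, l, v) (ill_posed \<inter> fibre v))))"
    unfolding real_norm_def .
next
  fix A :: "complex ^ 'n ^ 'n" and l :: complex and v :: "complex ^ 'n"
  assume "(A, l, v) \<in> well_posed"
  then show "cond_number (A, l, v) \<le>
      max 1 (1 / sqrt (1 + (cmod l)\<^sup>2 / (norm A)\<^sup>2) *
             (1 / sin (proj2_setdist (A, l, v) (ill_posed \<inter> fibre v))))"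
    by (rule cond_number_le)
qed

end
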